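(* Let $M=\mathrm{diag}\{M_i\}$, $D=\mathrm{diag}\{D_i\}$ with $M_i>0$, $D_i>0$ for $i=1,\dots,N$, and let $T\in\mathbb{R}^{N\times N}$ be given by $T_{ij}=-t_{ij}$ for $i\neq j$ and $T_{ii}=\sum_{j\ne i}t_{ij}$, with $t_{ij}=t_{ji}\ge 0$ for all $i\ne j$. Consider the hierarchically decentralized frequency control system $$\dot{\boldsymbol{\delta}}=\boldsymbol{\omega},\qquad M\dot{\boldsymbol{\omega}}+D\boldsymbol{\omega}+T\boldsymbol{\delta}=-\mathbf{P}_{ML}-\mathbf{P}_{MG}-\mathbf{P}_L,$$ $$\mathbf{P}_{ML}=\mathrm{diag}\{K_{P,i}\}\,\boldsymbol{\omega},\qquad \bar\omega=\tfrac1N\mathbf{1}_N^T\boldsymbol{\omega},\qquad \dot P_g=K_I\,\bar\omega,\qquad \mathbf{P}_{MG}=\mathbf{1}_N P_g,$$ where $\mathbf{1}_N\in\mathbb{R}^N$ is the all-ones column vector and $\mathbf{P}_L$ is the external load variation. If the global integral gain $K_I$ and all local proportional gains $K_{P,i}$, $i=1,\dots,N$, are positive, then the overall system with input $\mathbf{P}_L$ and output $\boldsymbol{\omega}$ has finite $L_2$-gain.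
   Context: A system with input $u$, output $y$ and state $x$ has finite $L_2$-gain if there exist a constant $\gamma\ge 0$ and a nonnegative function $\beta$ of the initial state $x(0)$ such that along every solution $\int_0^t\|y\|^2d\tau\le\gamma^2\int_0^t\|u\|^2d\tau+\beta(x(0))$ for all $t\ge 0$. *)

theory Defs
  imports "HOL-Analysis.Analysis"
begin

definition diag_matrix :: "('n \<Rightarrow> real) \<Rightarrow> real^'n^'n" where
  "diag_matrix d = (\<chi> i j. if i = j then d i else 0)"

text \<open>The diagonal values \<open>t i i\<close> do not enter.\<close>

definition coupling_matrix :: "('n::finite \<Rightarrow> 'n \<Rightarrow> real) \<Rightarrow> real^'n^'n" where
  "coupling_matrix t = (\<chi> i j. if i = j then (\<Sum>k \<in> UNIV - {i}. t i k) else - t i j)"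

text \<open>
  Signals live on the half-line of nonnegative times, represented by functions on the reals
  whose values at negative times are never used. Inputs range over the extended space of
  measurable signals that are square integrable on every bounded interval, which allows, for
  instance, step changes.
\<close>

definition L2e :: "(real \<Rightarrow> 'a::euclidean_space) set" where
  "L2e = {u. u \<in> borel_measurable (lebesgue_on {0..}) \<and>
             (\<forall>t\<ge>0. (\<lambda>\<tau>. (norm (u \<tau>))\<^sup>2) integrable_on {0..t})}"

text \<open>
  As inputs may be discontinuous, differential equations are understood in the sense of
  Caratheodory: \<open>z\<close> is locally absolutely continuous with derivative \<open>z'\<close> almost everywhere,
  written as \<open>z\<close> being an indefinite Lebesgue integral of \<open>z'\<close>. Every continuously
  differentiable function with its derivative is covered.
\<close>

definition has_ac_derivative ::
  "(real \<Rightarrow> 'a::euclidean_space) \<Rightarrow> (real \<Rightarrow> 'a) \<Rightarrow> bool" where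
  "has_ac_derivative z z' \<longleftrightarrow>
     (\<forall>t\<ge>0. z' absolutely_integrable_on {0..t} \<and> z t = z 0 + integral {0..t} z')"

text \<open>
  A system is given by its set of solutions: \<open>sys u x y\<close> means that \<open>x\<close> is a state trajectory
  under the input \<open>u\<close>, with output \<open>y\<close>. The integrability conjunct excludes the junk value \<open>0\<close>
  of the integral of a non-integrable function.
\<close>

definition finite_L2_gain ::
  "((real \<Rightarrow> 'u::euclidean_space) \<Rightarrow> (real \<Rightarrow> 'x) \<Rightarrow> (real \<Rightarrow> 'y::euclidean_space) \<Rightarrow> bool) \<Rightarrow> bool" where
  "finite_L2_gain sys \<longleftrightarrow>
     (\<exists>\<gamma> \<ge> 0. \<exists>\<beta> :: 'x \<Rightarrow> real. (\<forall>x0. 0 \<le> \<beta> x0) \<and>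
        (\<forall>u \<in> L2e. \<forall>x y. sys u x y \<longrightarrow>
           (\<forall>t\<ge>0. (\<lambda>\<tau>. (norm (y \<tau>))\<^sup>2) integrable_on {0..t} \<and>
              integral {0..t} (\<lambda>\<tau>. (norm (y \<tau>))\<^sup>2)
                \<le> \<gamma>\<^sup>2 * integral {0..t} (\<lambda>\<tau>. (norm (u \<tau>))\<^sup>2) + \<beta> (x 0))))"

text \<open>
  The closed loop with input \<open>P\<^sub>L\<close>, state \<open>(\<delta>, \<omega>, P\<^sub>g)\<close> and output \<open>\<omega>\<close>. The constant \<open>1\<close> of type
  \<open>real^'n\<close> is the all-ones vector. The equations hold at all times rather than almost
  everywhere; this is no restriction, because \<open>\<delta>'\<close>, \<open>\<omega>'\<close> and \<open>P\<^sub>g'\<close> are determined by the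
  trajectory only up to a null set.
\<close>

definition frequency_control_system ::
  "real^'n^'n \<Rightarrow> real^'n^'n \<Rightarrow> real^'n^'n \<Rightarrow> ('n \<Rightarrow> real) \<Rightarrow> real \<Rightarrow>
   (real \<Rightarrow> real^'n) \<Rightarrow> (real \<Rightarrow> (real^'n) \<times> (real^'n) \<times> real) \<Rightarrow> (real \<Rightarrow> real^'n) \<Rightarrow> bool" where
  "frequency_control_system M D T K\<^sub>P K\<^sub>I P\<^sub>L x y \<longleftrightarrow>
     (\<exists>\<delta> \<delta>' \<omega> \<omega>' P\<^sub>g P\<^sub>g' P\<^sub>M\<^sub>L P\<^sub>M\<^sub>G \<omega>\<^sub>a\<^sub>v\<^sub>g.
        has_ac_derivative \<delta> \<delta>' \<and> has_ac_derivative \<omega> \<omega>' \<and> has_ac_derivative P\<^sub>g P\<^sub>g' \<and>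
        (\<forall>t\<ge>0.
           x t = (\<delta> t, \<omega> t, P\<^sub>g t) \<and>
           y t = \<omega> t \<and>
           \<delta>' t = \<omega> t \<and>
           M *v \<omega>' t + D *v \<omega> t + T *v \<delta> t = - P\<^sub>M\<^sub>L t - P\<^sub>M\<^sub>G t - P\<^sub>L t \<and>
           P\<^sub>M\<^sub>L t = diag_matrix K\<^sub>P *v \<omega> t \<and>
           \<omega>\<^sub>a\<^sub>v\<^sub>g t = (1 / real CARD('n)) * (1 \<bullet> \<omega> t) \<and>
           P\<^sub>g' t = K\<^sub>I * \<omega>\<^sub>a\<^sub>v\<^sub>g t \<and>
           P\<^sub>M\<^sub>G t = P\<^sub>g t *\<^sub>R 1))"

end

theory Submission
  imports Defs
begin

text \<open>
  Twice the total energy, \<open>V = \<omega> \<bullet> M \<omega> + \<delta> \<bullet> T \<delta> + (N / K\<^sub>I) P\<^sub>g\<^sup>2\<close>, is a storage function: it is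
  nonnegative because the coupling matrix is a graph Laplacian, and along solutions the exchange
  terms between \<open>\<omega>\<close>, \<open>\<delta>\<close> and \<open>P\<^sub>g\<close> cancel, which leaves
  \<open>V' = - 2 \<omega> \<bullet> (D + K\<^sub>P) \<omega> - 2 \<omega> \<bullet> P\<^sub>L \<le> - c \<parallel>\<omega>\<parallel>\<^sup>2 + \<parallel>P\<^sub>L\<parallel>\<^sup>2 / c\<close> with \<open>c = min\<^sub>i (D\<^sub>i + K\<^sub>P\<^sub>,\<^sub>i)\<close>.
  Integration gives the gain \<open>1 / c\<close> and the bias \<open>V(0) / c\<close>.
\<close>

section \<open>Calculus of locally absolutely continuous functions\<close>

lemma has_integral_diff_interval:
  fixes f :: "real \<Rightarrow> 'a::banach"
  assumes "f integrable_on {c..d}" and "c \<le> a" and "a \<le> b" and "b \<le> d"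
  shows "(f has_integral (integral {c..b} f - integral {c..a} f)) {a..b}"
proof -
  have "f integrable_on {c..b}" "f integrable_on {a..b}"
    using assms by (auto intro!: integrable_subinterval_real[OF assms(1)])
  then show ?thesis
    using Henstock_Kurzweil_Integration.integral_combine[OF assms(2,3), of f]
    by (metis add_diff_cancel_left' integrable_integral)
qed

lemma has_ac_derivativeD:
  assumes "has_ac_derivative f f'" and "0 \<le> t"
  shows "f' absolutely_integrable_on {0..t}" and "f' integrable_on {0..t}"
    and "f t = f 0 + integral {0..t} f'"
proof -
  have *: "f' absolutely_integrable_on {0..t} \<and> f t = f 0 + integral {0..t} f'"
    using assms unfolding has_ac_derivative_def by (elim allE[of _ t] impE)
  show "f t = f 0 + integral {0..t} f'"
    using * by (rule conjunct2)
  show "f' absolutely_integrable_on {0..t}"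
    using * by (rule conjunct1)
  then show "f' integrable_on {0..t}"
    by (simp add: absolutely_integrable_on_def)
qed

lemma has_ac_derivative_continuous_on:
  assumes "has_ac_derivative f f'"
  shows "continuous_on {0..t} f"
proof (cases "t \<ge> 0")
  case True
  then have "f' integrable_on {0..t}"
    using assms has_ac_derivativeD(2) by blast
  then have "continuous_on {0..t} (\<lambda>s. f 0 + integral {0..s} f')"
    by (intro continuous_intros indefinite_integral_continuous_1)
  moreover have "f 0 + integral {0..s} f' = f s" if "s \<in> {0..t}" for s
    by (rule has_ac_derivativeD(3)[OF assms, symmetric]) (use that in simp)
  ultimately show ?thesis
    by (rule continuous_on_eq)
qed auto

text \<open>The definition anchors the integral at time 0; additivity over adjacent intervals moves
  the left end to any \<open>a\<close>, as the local estimate in the product rule requires.\<close>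

lemma has_ac_derivative_has_integral:
  assumes "has_ac_derivative f f'" and "0 \<le> a" and "a \<le> b"
  shows "(f' has_integral (f b - f a)) {a..b}"
proof -
  have "f' integrable_on {0..b}"
    using assms has_ac_derivativeD(2) order_trans by blast
  then have "(f' has_integral (integral {0..b} f' - integral {0..a} f')) {a..b}"
    using assms(2,3) by (rule has_integral_diff_interval) simp
  moreover have "f b = f 0 + integral {0..b} f'" "f a = f 0 + integral {0..a} f'"
    using assms has_ac_derivativeD(3) order_trans by blast+
  ultimately show ?thesis by (metis add_diff_cancel_left)
qed

lemma has_ac_derivative_add:
  assumes "has_ac_derivative f f'" and "has_ac_derivative g g'"
  shows "has_ac_derivative (\<lambda>t. f t + g t) (\<lambda>t. f' t + g' t)"
  unfolding has_ac_derivative_def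
proof (intro allI impI conjI)
  fix t :: real
  assume "0 \<le> t"
  then have *: "f' absolutely_integrable_on {0..t}" "g' absolutely_integrable_on {0..t}"
    "f t = f 0 + integral {0..t} f'" "g t = g 0 + integral {0..t} g'"
    using assms has_ac_derivativeD by blast+
  show "(\<lambda>t. f' t + g' t) absolutely_integrable_on {0..t}"
    using *(1,2) by (rule set_integral_add)
  have "integral {0..t} (\<lambda>t. f' t + g' t) = integral {0..t} f' + integral {0..t} g'"
    using *(1,2) by (intro Henstock_Kurzweil_Integration.integral_add)
      (auto simp: absolutely_integrable_on_def)
  then show "f t + g t = f 0 + g 0 + integral {0..t} (\<lambda>t. f' t + g' t)"
    by (subst *(3), subst *(4)) simp
qed

lemma has_ac_derivative_bounded_linear:
  assumes "bounded_linear h" and "has_ac_derivative f f'"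
  shows "has_ac_derivative (\<lambda>t. h (f t)) (\<lambda>t. h (f' t))"
  unfolding has_ac_derivative_def
proof (intro allI impI conjI)
  fix t :: real
  assume "0 \<le> t"
  then have *: "f' absolutely_integrable_on {0..t}" "f t = f 0 + integral {0..t} f'"
    using assms(2) has_ac_derivativeD by blast+
  show "(\<lambda>t. h (f' t)) absolutely_integrable_on {0..t}"
    using absolutely_integrable_linear[OF *(1) assms(1)] by (simp add: o_def)
  have "integral {0..t} (h \<circ> f') = h (integral {0..t} f')"
    using *(1) assms(1) by (intro integral_linear) (auto simp: absolutely_integrable_on_def)
  then show "h (f t) = h (f 0) + integral {0..t} (\<lambda>t. h (f' t))"
    by (subst *(2)) (simp add: o_def linear_simps[OF assms(1)])
qed

text \<open>
  On a short interval around \<open>x\<close> the defect of the product formula is at most \<open>\<epsilon>\<close> times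
  the integral of \<open>\<parallel>f'\<parallel> + \<parallel>g'\<parallel>\<close>, by continuity of \<open>f\<close> and \<open>g\<close>. This bound is additive over adjacent
  intervals, so bisection extends it to \<open>[0, T]\<close>, where \<open>\<epsilon>\<close> can be sent to zero.
\<close>

lemma has_ac_derivative_bilinear:
  fixes h :: "'a::euclidean_space \<Rightarrow> 'b::euclidean_space \<Rightarrow> 'c::euclidean_space"
  assumes "bounded_bilinear h" and f: "has_ac_derivative f f'" and g: "has_ac_derivative g g'"
  shows "has_ac_derivative (\<lambda>t. h (f t) (g t)) (\<lambda>t. h (f t) (g' t) + h (f' t) (g t))"
    (is "has_ac_derivative _ ?p")
  unfolding has_ac_derivative_def
proof (intro allI impI)
  fix T :: real
  assume "0 \<le> T"
  interpret h: bounded_bilinear h by fact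
  have cont: "continuous_on {0..T} f" "continuous_on {0..T} g"
    using f g by (auto intro: has_ac_derivative_continuous_on)
  have abs: "f' absolutely_integrable_on {0..T}" "g' absolutely_integrable_on {0..T}"
    using f g \<open>0 \<le> T\<close> has_ac_derivativeD(1) by blast+
  \<comment> \<open>The undifferentiated factor is continuous on a compact interval, hence
    measurable and bounded there, so its product with an absolutely integrable function is
    absolutely integrable.\<close>
  have "(\<lambda>t. h (f t) (g' t)) absolutely_integrable_on {0..T}"
    by (rule absolutely_integrable_bounded_measurable_product)
      (use cont abs \<open>bounded_bilinear h\<close> in \<open>auto simp: bilinear_conv_bounded_bilinear
        intro!: continuous_imp_measurable_on_sets_lebesgue compact_imp_bounded
          compact_continuous_image\<close>)
  moreover have "(\<lambda>t. h (f' t) (g t)) absolutely_integrable_on {0..T}"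
    by (rule absolutely_integrable_bounded_measurable_product[where h = "\<lambda>y x. h x y"])
      (use cont abs h.flip in \<open>auto simp: bilinear_conv_bounded_bilinear
        intro!: continuous_imp_measurable_on_sets_lebesgue compact_imp_bounded
          compact_continuous_image\<close>)
  ultimately have p: "?p absolutely_integrable_on {0..T}"
    by (rule set_integral_add)
  then have p_int: "?p integrable_on {0..T}"
    by (simp add: absolutely_integrable_on_def)
  define q where "q s = norm (f' s) + norm (g' s)" for s
  \<comment> \<open>\<open>F\<close> is the running defect, so the product formula amounts to
    \<open>F T = F 0\<close>. The increment of \<open>V\<close> over an interval is the integral of
    \<open>q\<close>, which makes the bound additive.\<close>
  define F where "F t = h (f t) (g t) - integral {0..t} ?p" for t
  define V where "V t = integral {0..t} q" for t
  have q_int: "q integrable_on {0..T}"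
    unfolding q_def using abs
    by (auto simp: absolutely_integrable_on_def intro: integrable_add)
  obtain K where "K > 0" and K: "\<And>a b. norm (h a b) \<le> norm a * norm b * K"
    using h.pos_bounded by blast
  have bound: "norm (F T - F 0) \<le> e * (K * V T)" if "e > 0" for e
  proof -
    \<comment> \<open>The guard \<open>0 \<le> a \<and> b \<le> T\<close> handles the local case of
      bisection, whose short intervals around \<open>x\<close> may stick out of
      \<open>{0..T}\<close>.\<close>
    have "0 \<le> (0::real) \<and> T \<le> T \<longrightarrow> norm (F T - F 0) \<le> e * (K * (V T - V 0))"
      using \<open>0 \<le> T\<close>
    proof (induction rule: Bolzano[where P = "\<lambda>a b. 0 \<le> a \<and> b \<le> T \<longrightarrow>
        norm (F b - F a) \<le> e * (K * (V b - V a))"])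
      case (trans a b c)
      show ?case
      proof (intro impI)
        assume "0 \<le> a \<and> c \<le> T"
        then have "norm (F b - F a) \<le> e * (K * (V b - V a))"
          "norm (F c - F b) \<le> e * (K * (V c - V b))"
          using trans by auto
        moreover have "norm (F c - F a) \<le> norm (F b - F a) + norm (F c - F b)"
          using norm_triangle_ineq[of "F b - F a" "F c - F b"] by simp
        ultimately show "norm (F c - F a) \<le> e * (K * (V c - V a))"
          by (simp add: algebra_simps)
      qed
    next
      case (local x)
      then have "x \<in> {0..T}" by simp
      then obtain d1 d2 where "d1 > 0" "d2 > 0"
        and d1: "\<And>s. s \<in> {0..T} \<Longrightarrow> dist s x < d1 \<Longrightarrow> dist (f s) (f x) < e / 2"
        and d2: "\<And>s. s \<in> {0..T} \<Longrightarrow> dist s x < d2 \<Longrightarrow> dist (g s) (g x) < e / 2"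
        using cont \<open>e > 0\<close> unfolding continuous_on_iff by (metis half_gt_zero)
      have "norm (F b - F a) \<le> e * (K * (V b - V a))"
        if "a \<le> x" "x \<le> b" "b - a < min d1 d2" "0 \<le> a" "b \<le> T" for a b
      proof -
        have ab: "a \<le> b" "{a..b} \<subseteq> {0..T}" using that by auto
        have p_ab: "(?p has_integral (integral {0..b} ?p - integral {0..a} ?p)) {a..b}"
          and q_ab: "(q has_integral (V b - V a)) {a..b}"
          unfolding V_def using p_int q_int \<open>0 \<le> a\<close> ab(1) \<open>b \<le> T\<close>
          by (blast intro: has_integral_diff_interval)+
        \<comment> \<open>With \<open>g\<close> frozen at \<open>b\<close> and \<open>f\<close>
          frozen at \<open>a\<close>, both terms integrate exactly, and the two integrals add up to
          \<open>h (f b) (g b) - h (f a) (g a)\<close>. Subtracting \<open>?p\<close> leaves only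
          the small factors \<open>g b - g s\<close> and \<open>f a - f s\<close>.\<close>
        have "((\<lambda>s. h (f' s) (g b)) has_integral h (f b - f a) (g b)) {a..b}"
          using has_integral_linear[OF has_ac_derivative_has_integral[OF f \<open>0 \<le> a\<close> ab(1)]
              h.bounded_linear_left] by (simp add: o_def)
        moreover have "((\<lambda>s. h (f a) (g' s)) has_integral h (f a) (g b - g a)) {a..b}"
          using has_integral_linear[OF has_ac_derivative_has_integral[OF g \<open>0 \<le> a\<close> ab(1)]
              h.bounded_linear_right] by (simp add: o_def)
        ultimately have "((\<lambda>s. h (f' s) (g b) + h (f a) (g' s) - ?p s) has_integral
            h (f b - f a) (g b) + h (f a) (g b - g a)
              - (integral {0..b} ?p - integral {0..a} ?p)) {a..b}"
          using p_ab by (intro has_integral_diff has_integral_add)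
        then have F_ab: "((\<lambda>s. h (f' s) (g b - g s) + h (f a - f s) (g' s)) has_integral
            (F b - F a)) {a..b}"
          by (simp add: F_def h.diff_left h.diff_right algebra_simps)
        have "norm (h (f' s) (g b - g s) + h (f a - f s) (g' s)) \<le> e * K * q s"
          if "s \<in> {a..b}" for s
        proof -
          have "dist (f a) (f x) < e / 2" "dist (f s) (f x) < e / 2"
            "dist (g b) (g x) < e / 2" "dist (g s) (g x) < e / 2"
            using that ab \<open>a \<le> x\<close> \<open>x \<le> b\<close> \<open>b - a < min d1 d2\<close>
            by (intro d1 d2; force simp: dist_real_def)+
          then have "norm (f a - f s) \<le> e" "norm (g b - g s) \<le> e"
            unfolding dist_norm[symmetric] by (metis dist_triangle_half_l less_imp_le dist_commute)+
          then have "norm (f' s) * norm (g b - g s) * K \<le> norm (f' s) * e * K"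
            "norm (f a - f s) * norm (g' s) * K \<le> e * norm (g' s) * K"
            using \<open>K > 0\<close> \<open>e > 0\<close> by (intro mult_right_mono mult_left_mono; simp)+
          moreover have "e * K * q s = norm (f' s) * e * K + e * norm (g' s) * K"
            by (simp add: q_def distrib_left)
          ultimately show ?thesis
            using K[of "f' s" "g b - g s"] K[of "f a - f s" "g' s"]
              norm_triangle_ineq[of "h (f' s) (g b - g s)" "h (f a - f s) (g' s)"]
            by linarith
        qed
        then have "norm (integral {a..b} (\<lambda>s. h (f' s) (g b - g s) + h (f a - f s) (g' s)))
            \<le> integral {a..b} (\<lambda>s. e * K * q s)"
          using F_ab has_integral_mult_right[OF q_ab]
          by (intro Henstock_Kurzweil_Integration.integral_norm_bound_integral) blast+
        then show ?thesis
          using integral_unique[OF F_ab] integral_unique[OF q_ab]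
          by (simp add: mult.assoc)
      qed
      then show ?case
        using \<open>d1 > 0\<close> \<open>d2 > 0\<close> by (intro exI[of _ "min d1 d2"]) auto
    qed
    then show ?thesis by (simp add: V_def)
  qed
  have "F T = F 0"
  proof (rule ccontr)
    assume "F T \<noteq> F 0"
    then have pos: "norm (F T - F 0) > 0" by simp
    \<comment> \<open>The bound with \<open>e = 1\<close> shows \<open>C > 0\<close>. With
      \<open>e = norm (F T - F 0) / (2 * C)\<close> it then says that a positive number is at most
      half of itself.\<close>
    define C where "C = K * V T"
    have "C > 0"
      using bound[of 1] pos unfolding C_def by linarith
    then have "norm (F T - F 0) / (2 * C) * C = norm (F T - F 0) / 2"
      by simp
    then show False
      using bound[of "norm (F T - F 0) / (2 * C)"] pos \<open>C > 0\<close> by (simp flip: C_def)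
  qed
  with p show "?p absolutely_integrable_on {0..T} \<and>
      h (f T) (g T) = h (f 0) (g 0) + integral {0..T} ?p"
    by (simp add: F_def algebra_simps)
qed

section \<open>Quadratic forms of symmetric, diagonal and coupling matrices\<close>

lemma inner_matrix_vector_symmetric:
  fixes A :: "real^'n^'n"
  assumes "transpose A = A"
  shows "x \<bullet> (A *v y) = (A *v x) \<bullet> y"
  using dot_lmul_matrix[of x A y] transpose_matrix_vector[of A x] assms by simp

text \<open>Symmetry of \<open>A\<close> makes the two terms of the product rule equal, whence the
  factor 2.\<close>

lemma has_ac_derivative_quadratic_form:
  fixes A :: "real^'n^'n"
  assumes "transpose A = A" and "has_ac_derivative z z'"
  shows "has_ac_derivative (\<lambda>t. z t \<bullet> (A *v z t)) (\<lambda>t. 2 * (z t \<bullet> (A *v z' t)))"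
proof -
  have "has_ac_derivative (\<lambda>t. A *v z t) (\<lambda>t. A *v z' t)"
    using matrix_vector_mul_bounded_linear assms(2) by (rule has_ac_derivative_bounded_linear)
  from has_ac_derivative_bilinear[OF bounded_bilinear_inner assms(2) this]
  moreover have "z' t \<bullet> (A *v z t) = z t \<bullet> (A *v z' t)" for t
    using inner_matrix_vector_symmetric[OF assms(1), of "z' t" "z t"] inner_commute by metis
  ultimately show ?thesis by simp
qed

lemma diag_matrix_mult_vec_nth: "(diag_matrix d *v x) $ i = d i * x $ i"
  by (simp add: diag_matrix_def matrix_vector_mult_def if_distrib[of "\<lambda>a. a * _"] cong: if_cong)

lemma inner_diag_matrix: "x \<bullet> (diag_matrix d *v x) = (\<Sum>i\<in>UNIV. d i * (x $ i)\<^sup>2)"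
  by (simp add: inner_vec_def diag_matrix_mult_vec_nth power2_eq_square mult_ac)

lemma transpose_diag_matrix: "transpose (diag_matrix d) = diag_matrix d"
  by (simp add: transpose_def diag_matrix_def vec_eq_iff)

lemma transpose_coupling_matrix:
  assumes "\<And>i j. i \<noteq> j \<Longrightarrow> t i j = t j i"
  shows "transpose (coupling_matrix t) = coupling_matrix t"
  using assms by (auto simp: transpose_def coupling_matrix_def vec_eq_iff)

text \<open>This is the Dirichlet form of the weighted graph Laplacian. Each row yields a weighted
  sum of differences, and adding the form with \<open>i\<close> and \<open>j\<close> exchanged
  produces the squares. Ordered pairs count every edge twice, whence the factor 2.\<close>

lemma inner_coupling_matrix:
  assumes "\<And>i j. i \<noteq> j \<Longrightarrow> t i j = t j i"
  shows "2 * (x \<bullet> (coupling_matrix t *v x)) =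
    (\<Sum>i\<in>UNIV. \<Sum>j\<in>UNIV - {i}. t i j * (x $ i - x $ j)\<^sup>2)"
proof -
  \<comment> \<open>Extending the weights by zero on the diagonal lets both sums range over all of
    \<open>UNIV\<close>, so they can be swapped, and makes the weights symmetric for all index
    pairs.\<close>
  define a where "a i j = (if i = j then 0 else t i j)" for i j
  have a_sym: "a i j = a j i" for i j
    using assms by (simp add: a_def)
  have off: "(\<Sum>j\<in>UNIV - {i}. t i j * r j) = (\<Sum>j\<in>UNIV. a i j * r j)" for i and r :: "'a \<Rightarrow> real"
    by (rule sum.mono_neutral_cong_left) (auto simp: a_def)
  have row: "(coupling_matrix t *v x) $ i = (\<Sum>j\<in>UNIV. a i j * (x $ i - x $ j))" for i
  proof -
    have "(coupling_matrix t *v x) $ i =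
        (\<Sum>j\<in>UNIV. coupling_matrix t $ i $ j * x $ j)"
      by (simp add: matrix_vector_mult_def)
    also have "\<dots> = (\<Sum>k\<in>UNIV - {i}. t i k) * x $ i - (\<Sum>j\<in>UNIV - {i}. t i j * x $ j)"
      by (subst sum.remove[of _ i]) (simp_all add: coupling_matrix_def flip: sum_negf)
    also have "\<dots> = (\<Sum>j\<in>UNIV - {i}. t i j * (x $ i - x $ j))"
      by (simp add: sum_distrib_right sum_subtractf right_diff_distrib)
    finally show ?thesis by (simp only: off)
  qed
  have "x \<bullet> (coupling_matrix t *v x) = (\<Sum>i\<in>UNIV. \<Sum>j\<in>UNIV. a i j * (x $ i * (x $ i - x $ j)))"
    (is "_ = ?S")
    by (simp add: inner_vec_def row sum_distrib_left mult_ac)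
  moreover have "?S = (\<Sum>i\<in>UNIV. \<Sum>j\<in>UNIV. a i j * (x $ j * (x $ j - x $ i)))"
    by (subst sum.swap) (simp add: a_sym)
  ultimately have "2 * (x \<bullet> (coupling_matrix t *v x)) =
      (\<Sum>i\<in>UNIV. \<Sum>j\<in>UNIV. a i j * (x $ i * (x $ i - x $ j)) + a i j * (x $ j * (x $ j - x $ i)))"
    by (simp add: sum.distrib)
  also have "\<dots> = (\<Sum>i\<in>UNIV. \<Sum>j\<in>UNIV. a i j * (x $ i - x $ j)\<^sup>2)"
    by (intro sum.cong) (auto simp: power2_eq_square algebra_simps)
  finally show ?thesis by (simp only: off)
qed

lemma inner_coupling_matrix_nonneg:
  assumes "\<And>i j. i \<noteq> j \<Longrightarrow> t i j = t j i" and "\<And>i j. i \<noteq> j \<Longrightarrow> t i j \<ge> 0"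
  shows "x \<bullet> (coupling_matrix t *v x) \<ge> 0"
proof -
  have "2 * (x \<bullet> (coupling_matrix t *v x)) =
      (\<Sum>i\<in>UNIV. \<Sum>j\<in>UNIV - {i}. t i j * (x $ i - x $ j)\<^sup>2)"
    using assms(1) by (rule inner_coupling_matrix)
  also have "\<dots> \<ge> 0"
    using assms(2) by (intro sum_nonneg mult_nonneg_nonneg) auto
  finally show ?thesis by simp
qed

text \<open>
  Completing the square: \<open>2 w \<bullet> u \<ge> - c \<parallel>w\<parallel>\<^sup>2 - \<parallel>u\<parallel>\<^sup>2 / c\<close>.
\<close>

lemma dissipation_bound:
  fixes w u :: "real^'n"
  assumes "c > 0" and "\<And>i. c \<le> d i"
  shows "- 2 * (w \<bullet> (diag_matrix d *v w)) - 2 * (w \<bullet> u)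
    \<le> - c * (norm w)\<^sup>2 + (norm u)\<^sup>2 / c"
proof -
  have "c * (norm w)\<^sup>2 = (\<Sum>i\<in>UNIV. c * (w $ i)\<^sup>2)"
    unfolding power2_norm_eq_inner inner_vec_def by (simp add: power2_eq_square sum_distrib_left)
  also have "\<dots> \<le> w \<bullet> (diag_matrix d *v w)"
    unfolding inner_diag_matrix using assms(2) by (intro sum_mono mult_right_mono) auto
  finally have 1: "c * (norm w)\<^sup>2 \<le> w \<bullet> (diag_matrix d *v w)" .
  \<comment> \<open>Doubling fact \<open>1\<close> gives two copies of
    \<open>c * (norm w)\<^sup>2\<close>: one absorbs the cross term, the other survives in the
    bound.\<close>
  have "0 \<le> (norm (c *\<^sub>R w + u))\<^sup>2 / c"
    using \<open>c > 0\<close> by simp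
  also have "\<dots> = c * (norm w)\<^sup>2 + 2 * (w \<bullet> u) + (norm u)\<^sup>2 / c"
    using \<open>c > 0\<close>
    by (simp add: power2_norm_eq_inner inner_add_left inner_add_right inner_commute field_simps)
  finally show ?thesis using 1 by simp
qed

section \<open>Energy balance and integration of the dissipation inequality\<close>

theorem proposition5:
  fixes M D K\<^sub>P :: "'n::finite \<Rightarrow> real"
    and t :: "'n \<Rightarrow> 'n \<Rightarrow> real"
    and K\<^sub>I :: real
  assumes "\<And>i. M i > 0"
    and "\<And>i. D i > 0"
    and "\<And>i j. i \<noteq> j \<Longrightarrow> t i j = t j i"
    and "\<And>i j. i \<noteq> j \<Longrightarrow> t i j \<ge> 0"
    and "K\<^sub>I > 0"
    and "\<And>i. K\<^sub>P i > 0"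
  shows "finite_L2_gain
    (frequency_control_system (diag_matrix M) (diag_matrix D) (coupling_matrix t) K\<^sub>P K\<^sub>I)"
proof -
  let ?M = "diag_matrix M" and ?D = "diag_matrix D" and ?K = "diag_matrix K\<^sub>P"
    and ?T = "coupling_matrix t"
  let ?N = "real CARD('n)"
  define c where "c = (MIN i. D i + K\<^sub>P i)"
  have c_le: "c \<le> D i + K\<^sub>P i" for i
    unfolding c_def by (rule Min_le) auto
  have "c > 0"
    unfolding c_def using assms(2,6) by (subst Min_gr_iff) (auto simp: add_pos_pos)
  \<comment> \<open>The weight \<open>?N / K\<^sub>I\<close> undoes the factor
    \<open>K\<^sub>I / ?N\<close> of the averaging integrator, so that the controller term cancels
    against \<open>p r * (1 \<bullet> \<omega> r)\<close>. Writing \<open>p * p\<close> fits the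
    bilinear product rule.\<close>
  define V where "V = (\<lambda>(d :: real^'n, w :: real^'n, p :: real).
    w \<bullet> (?M *v w) + d \<bullet> (?T *v d) + ?N / K\<^sub>I * (p * p))"
  have T_sym: "transpose ?T = ?T"
    using assms(3) by (rule transpose_coupling_matrix)
  have T_nonneg: "d \<bullet> (?T *v d) \<ge> 0" for d
    using assms(3,4) by (rule inner_coupling_matrix_nonneg)
  have V_nonneg: "V z \<ge> 0" for z
    unfolding V_def case_prod_beta inner_diag_matrix
    using assms(1)[THEN less_imp_le] T_nonneg \<open>K\<^sub>I > 0\<close>
    by (auto intro!: add_nonneg_nonneg sum_nonneg)
  show ?thesis
    unfolding finite_L2_gain_def
  proof (intro exI[of _ "1 / c"] exI[of _ "\<lambda>z. V z / c"] conjI allI ballI impI)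
    fix u x y and s :: real
    assume u: "u \<in> L2e" and "s \<ge> 0"
      and sys: "frequency_control_system ?M ?D ?T K\<^sub>P K\<^sub>I u x y"
    from sys obtain \<delta> \<delta>' \<omega> \<omega>' p p' P\<^sub>M\<^sub>L P\<^sub>M\<^sub>G \<omega>\<^sub>a\<^sub>v\<^sub>g where
      ac: "has_ac_derivative \<delta> \<delta>'" "has_ac_derivative \<omega> \<omega>'" "has_ac_derivative p p'"
      and eqs: "\<forall>r\<ge>0. x r = (\<delta> r, \<omega> r, p r) \<and> y r = \<omega> r \<and> \<delta>' r = \<omega> r \<and>
        ?M *v \<omega>' r + ?D *v \<omega> r + ?T *v \<delta> r = - P\<^sub>M\<^sub>L r - P\<^sub>M\<^sub>G r - u r \<and>
        P\<^sub>M\<^sub>L r = ?K *v \<omega> r \<and> \<omega>\<^sub>a\<^sub>v\<^sub>g r = (1 / ?N) * (1 \<bullet> \<omega> r) \<and>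
        p' r = K\<^sub>I * \<omega>\<^sub>a\<^sub>v\<^sub>g r \<and> P\<^sub>M\<^sub>G r = p r *\<^sub>R 1"
      unfolding frequency_control_system_def by (elim exE conjE)
    have x: "x r = (\<delta> r, \<omega> r, p r)"
      and y: "y r = \<omega> r"
      and \<delta>': "\<delta>' r = \<omega> r"
      and \<omega>': "?M *v \<omega>' r + ?D *v \<omega> r + ?T *v \<delta> r = - (?K *v \<omega> r) - p r *\<^sub>R 1 - u r"
      and p': "p' r = K\<^sub>I * (1 / ?N * (1 \<bullet> \<omega> r))" if "r \<ge> 0" for r
      using eqs[rule_format, OF that] by simp_all
    \<comment> \<open>The summands are left unsimplified so that they match the conclusions of the
      differentiation rules literally.\<close>
    define V' where "V' r = 2 * (\<omega> r \<bullet> (?M *v \<omega>' r)) + 2 * (\<delta> r \<bullet> (?T *v \<delta>' r))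
      + ?N / K\<^sub>I * (p r * p' r + p' r * p r)" for r
    have V': "has_ac_derivative (\<lambda>r. V (\<delta> r, \<omega> r, p r)) V'"
      unfolding V_def V'_def case_prod_conv
      by (intro has_ac_derivative_add has_ac_derivative_quadratic_form transpose_diag_matrix
          T_sym ac
          has_ac_derivative_bounded_linear[OF bounded_linear_mult_right]
          has_ac_derivative_bilinear[OF bounded_bilinear_mult])
    have V'_le: "V' r \<le> - c * (norm (\<omega> r))\<^sup>2 + (norm (u r))\<^sup>2 / c" if "r \<ge> 0" for r
    proof -
      have DK: "diag_matrix (\<lambda>i. D i + K\<^sub>P i) *v \<omega> r = ?D *v \<omega> r + ?K *v \<omega> r"
        by (simp add: vec_eq_iff diag_matrix_mult_vec_nth distrib_right)
      have "?M *v \<omega>' r = - (?D *v \<omega> r + ?K *v \<omega> r) - ?T *v \<delta> r - p r *\<^sub>R 1 - u r"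
        using \<omega>'[OF that] by (simp add: algebra_simps eq_neg_iff_add_eq_0)
      then have "\<omega> r \<bullet> (?M *v \<omega>' r) = - (\<omega> r \<bullet> (?D *v \<omega> r + ?K *v \<omega> r))
          - \<omega> r \<bullet> (?T *v \<delta> r) - p r * (1 \<bullet> \<omega> r) - \<omega> r \<bullet> u r"
        by (simp only: inner_diff_right inner_minus_right inner_scaleR_right inner_commute)
      \<comment> \<open>By symmetry of \<open>?T\<close>, the potential energy gains exactly what
        the coupling term takes from the kinetic energy.\<close>
      moreover have "\<delta> r \<bullet> (?T *v \<delta>' r) = \<omega> r \<bullet> (?T *v \<delta> r)"
        using inner_matrix_vector_symmetric[OF T_sym] \<delta>'[OF that]
        by (metis inner_commute)
      moreover have "?N / K\<^sub>I * (p r * p' r + p' r * p r) = 2 * (p r * (1 \<bullet> \<omega> r))"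
        using p'[OF that] \<open>K\<^sub>I > 0\<close> by (simp add: field_simps)
      ultimately have "V' r = - 2 * (\<omega> r \<bullet> (diag_matrix (\<lambda>i. D i + K\<^sub>P i) *v \<omega> r)) - 2 * (\<omega> r \<bullet> u r)"
        unfolding V'_def DK by (simp add: algebra_simps)
      also have "\<dots> \<le> - c * (norm (\<omega> r))\<^sup>2 + (norm (u r))\<^sup>2 / c"
        using \<open>c > 0\<close> c_le by (rule dissipation_bound)
      finally show ?thesis .
    qed
    have \<omega>_int: "(\<lambda>r. (norm (\<omega> r))\<^sup>2) integrable_on {0..s}"
      using has_ac_derivative_continuous_on[OF ac(2)]
      by (intro integrable_continuous_real continuous_intros)
    \<comment> \<open>Output and frequency are known to agree only at nonnegative times, so
      integrals are transferred by congruence on \<open>{0..s}\<close>.\<close>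
    have y_\<omega>: "(norm (y r))\<^sup>2 = (norm (\<omega> r))\<^sup>2" if "r \<in> {0..s}" for r
      using y that by simp
    show "(\<lambda>r. (norm (y r))\<^sup>2) integrable_on {0..s}"
      using \<omega>_int by (rule integrable_eq) (simp only: y_\<omega>)
    have u_int: "(\<lambda>r. (norm (u r))\<^sup>2) integrable_on {0..s}"
      using u \<open>s \<ge> 0\<close> by (simp add: L2e_def)
    let ?I\<omega> = "integral {0..s} (\<lambda>r. (norm (\<omega> r))\<^sup>2)" and ?Iu = "integral {0..s} (\<lambda>r. (norm (u r))\<^sup>2)"
    have "((\<lambda>r. - c * (norm (\<omega> r))\<^sup>2 + (norm (u r))\<^sup>2 / c) has_integral - c * ?I\<omega> + ?Iu / c) {0..s}"
      using \<omega>_int u_int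
      by (intro has_integral_add has_integral_mult_right has_integral_divide integrable_integral)
    from has_integral_le[OF has_ac_derivative_has_integral[OF V' order_refl \<open>s \<ge> 0\<close>] this] V'_le
    have "V (\<delta> s, \<omega> s, p s) - V (\<delta> 0, \<omega> 0, p 0) \<le> - c * ?I\<omega> + ?Iu / c"
      by simp
    \<comment> \<open>The stored energy at time \<open>s\<close> is nonnegative and is dropped; a
      further division by \<open>c\<close> turns the factor \<open>1 / c\<close> of
      \<open>?Iu\<close> into the squared gain.\<close>
    then have "c * ?I\<omega> \<le> ?Iu / c + V (x 0)"
      using V_nonneg[of "(\<delta> s, \<omega> s, p s)"] x[of 0] by simp
    then have "?I\<omega> \<le> (?Iu / c + V (x 0)) / c"
      using \<open>c > 0\<close> by (simp add: pos_le_divide_eq mult.commute)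
    also have "\<dots> = (1 / c)\<^sup>2 * ?Iu + V (x 0) / c"
      by (simp add: add_divide_distrib power2_eq_square)
    finally show "integral {0..s} (\<lambda>r. (norm (y r))\<^sup>2) \<le> (1 / c)\<^sup>2 * ?Iu + V (x 0) / c"
      by (simp only: y_\<omega> cong: integral_cong)
  qed (use \<open>c > 0\<close> V_nonneg in auto)
qed

end
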